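(* Let $(X,d)$ be an infinite metric space and let $\mathfrak{B}$ be a bornology on $X$ with closed base, $X\notin\mathfrak{B}$. The following equalities hold (where an equality of two selection principles means that $X$ satisfies one if and only if it satisfies the other): (1) $S_1(\Gamma_{\mathfrak{B}^s},\Gamma_{\mathfrak{B}^s})=S_{fin}(\Gamma_{\mathfrak{B}^s},\Gamma_{\mathfrak{B}^s})$; (2) $S_1(\Gamma_{\mathfrak{B}^s},\Gamma)=S_{fin}(\Gamma_{\mathfrak{B}^s},\Gamma)$; (3) $S_1(\Gamma,\Gamma_{\mathfrak{B}^s})=S_{fin}(\Gamma,\Gamma_{\mathfrak{B}^s})$.
   Context: A bornology $\mathfrak{B}$ on $X$ is a family of subsets of $X$ that is closed under finite unions, hereditary (closed under taking subsets), and covers $X$. A base of $\mathfrak{B}$ is a subfamily of $\mathfrak{B}$ cofinal with respect to inclusion; it is closed if all its members are closed in $X$. For $B\in\mathfrak{B}$ and $\delta>0$, $B^\delta=\bigcup_{x\in B}\{y\in X: d(x,y)<\delta\}$. All open covers of $X$ are assumed to be countably infinite. A $\gamma$-cover of $X$ is an infinite open cover $\mathcal{U}$ such that each $x\in X$ belongs to all but finitely many members of $\mathcal{U}$; $\Gamma$ is the collection of all $\gamma$-covers. A $\gamma_{\mathfrak{B}^s}$-cover of $X$ is an open cover $\mathcal{U}=\{U_n:n\in\mathbb{N}\}$ which is infinite and such that for each $B\in\mathfrak{B}$ there are $n_0\in\mathbb{N}$ and a sequence $\{\delta_n:n\ge n_0\}$ of positive reals with $B^{\delta_n}\subseteq U_n$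 for all $n\ge n_0$; $\Gamma_{\mathfrak{B}^s}$ is the collection of all of these. $S_1(\mathcal{A},\mathcal{C})$: for each sequence $\{A_n:n\in\mathbb{N}\}$ of elements of $\mathcal{A}$ there is a sequence $\{b_n:n\in\mathbb{N}\}$ with $b_n\in A_n$ for each $n$ and $\{b_n:n\in\mathbb{N}\}\in\mathcal{C}$. $S_{fin}(\mathcal{A},\mathcal{C})$: for each sequence $\{A_n:n\in\mathbb{N}\}$ of elements of $\mathcal{A}$ there is a sequence $\{B_n:n\in\mathbb{N}\}$ of finite (possibly empty) sets with $B_n\subseteq A_n$ for each $n$ and $\bigcup_{n}B_n\in\mathcal{C}$. *)

theory Defs
  imports "HOL-Analysis.Analysis"
begin

text \<open>The metric space \<open>X\<close> is the type \<open>'a\<close>, so that \<open>UNIV\<close> plays the role of \<open>X\<close>.\<close>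

definition bornology :: "'a set set \<Rightarrow> bool" where
  "bornology \<BB> \<longleftrightarrow>
     (\<forall>\<F>. finite \<F> \<and> \<F> \<subseteq> \<BB> \<longrightarrow> \<Union>\<F> \<in> \<BB>) \<and>
     (\<forall>B\<in>\<BB>. \<forall>C. C \<subseteq> B \<longrightarrow> C \<in> \<BB>) \<and>
     \<Union>\<BB> = UNIV"

definition bornology_base :: "'a set set \<Rightarrow> 'a set set \<Rightarrow> bool" where
  "bornology_base \<BB>0 \<BB> \<longleftrightarrow> \<BB>0 \<subseteq> \<BB> \<and> (\<forall>B\<in>\<BB>. \<exists>C\<in>\<BB>0. B \<subseteq> C)"

definition has_closed_base :: "'a::topological_space set set \<Rightarrow> bool" where
  "has_closed_base \<BB> \<longleftrightarrow> (\<exists>\<BB>0. bornology_base \<BB>0 \<BB> \<and> (\<forall>C\<in>\<BB>0. closed C))"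

definition enlargement :: "'a::metric_space set \<Rightarrow> real \<Rightarrow> 'a set" where
  "enlargement B \<delta> = (\<Union>x\<in>B. ball x \<delta>)"

text \<open>Covers are sets of open sets, and all of them are taken to be countably infinite.
  The whole space is allowed as a member of a cover.\<close>

definition open_cover :: "'a::topological_space set set \<Rightarrow> bool" where
  "open_cover \<U> \<longleftrightarrow>
     countable \<U> \<and> infinite \<U> \<and> (\<forall>U\<in>\<U>. open U) \<and> \<Union>\<U> = UNIV"

definition gamma_covers :: "'a::topological_space set set set" where
  "gamma_covers = {\<U>. open_cover \<U> \<and> (\<forall>x. finite {U\<in>\<U>. x \<notin> U})}"

text \<open>The enumeration \<open>U\<close> may have repetitions. Since the cover is infinite as a set, passing to
  a subsequence that lists each member once shows that requiring \<open>U\<close> to be injective would give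
  the same collection.\<close>

definition gamma_bs_covers :: "'a::metric_space set set \<Rightarrow> 'a set set set" where
  "gamma_bs_covers \<BB> = {\<U>. open_cover \<U> \<and>
     (\<exists>U :: nat \<Rightarrow> 'a set. \<U> = range U \<and>
        (\<forall>B\<in>\<BB>. \<exists>n0. \<exists>\<delta> :: nat \<Rightarrow> real.
            \<forall>n\<ge>n0. \<delta> n > 0 \<and> enlargement B (\<delta> n) \<subseteq> U n))}"

definition S1 :: "'b set set \<Rightarrow> 'b set set \<Rightarrow> bool" where
  "S1 \<A> \<C> \<longleftrightarrow>
     (\<forall>A :: nat \<Rightarrow> 'b set. (\<forall>n. A n \<in> \<A>) \<longrightarrow>
        (\<exists>b :: nat \<Rightarrow> 'b. (\<forall>n. b n \<in> A n) \<and> range b \<in> \<C>))"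

definition Sfin :: "'b set set \<Rightarrow> 'b set set \<Rightarrow> bool" where
  "Sfin \<A> \<C> \<longleftrightarrow>
     (\<forall>A :: nat \<Rightarrow> 'b set. (\<forall>n. A n \<in> \<A>) \<longrightarrow>
        (\<exists>B :: nat \<Rightarrow> 'b set. (\<forall>n. finite (B n) \<and> B n \<subseteq> A n) \<and> (\<Union>n. B n) \<in> \<C>))"

end

theory Submission
  imports Defs
begin

text \<open>Only the passage from \<open>Sfin\<close> to \<open>S1\<close> has content. The three equivalences are
  instances of one statement about two families \<open>\<AA>\<close> and \<open>\<BB>\<close> of sets that cover the space
  (lemma \<open>S1_iff_Sfin_gamma_bs_covers\<close>), because an open set contains a point \<open>x\<close> iff it contains a
  ball around \<open>x\<close>, which makes \<open>gamma_covers\<close> the special case of \<open>gamma_bs_covers\<close> for the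
  family of all singletons (lemma \<open>gamma_covers_eq_gamma_bs_covers\<close>).

  Given covers \<open>{U n m | m}\<close> for \<open>n = 0, 1, \<dots>\<close>, the principle \<open>Sfin\<close> is applied to the
  intersections \<open>V n m = U 0 m \<inter> \<dots> \<inter> U n m\<close>. It yields finite sets \<open>W n\<close> whose union is an infinite
  cover, so for each \<open>n\<close> there remain elements of the union that come from a stage \<open>k \<ge> n\<close>. Such an
  element is some \<open>V k m\<close>, hence it is contained in the member \<open>U n m\<close> of the \<open>n\<close>-th cover, and this
  member is the one selected by \<open>S1\<close>. The elements are chosen so that none is used infinitely often;
  then each \<open>B\<close> lies uniformly inside all but finitely many of them, and a fortiori inside all
  but finitely many of the larger sets \<open>U n m\<close>.

  The recurring obstacle is that a cover has to be infinite as a set, whereas the sets \<open>V n m\<close> or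
  the selected sets might coincide for many indices. A set that occurs infinitely often in such a
  sequence contains every member of \<open>\<BB>\<close> and therefore equals the whole space; so it suffices to
  discard the whole space from all covers at the start
  (lemmas \<open>range_in_gamma_bs_covers\<close> and \<open>gamma_bs_coversE\<close>).\<close>

section \<open>Uniform containment\<close>

definition uniformly_inside :: "'a::metric_space set \<Rightarrow> 'a set \<Rightarrow> bool" where
  "uniformly_inside B U \<longleftrightarrow> (\<exists>\<delta>>0. enlargement B \<delta> \<subseteq> U)"

lemma uniformly_inside_mono:
  "uniformly_inside B U \<Longrightarrow> U \<subseteq> V \<Longrightarrow> uniformly_inside B V"
  unfolding uniformly_inside_def by blast

lemma uniformly_inside_imp_subset: "uniformly_inside B U \<Longrightarrow> B \<subseteq> U"
  unfolding uniformly_inside_def enlargement_def by force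

lemma uniformly_inside_Int:
  assumes "uniformly_inside B U" "uniformly_inside B V"
  shows "uniformly_inside B (U \<inter> V)"
proof -
  obtain d e where "d > 0" "e > 0" "enlargement B d \<subseteq> U" "enlargement B e \<subseteq> V"
    using assms unfolding uniformly_inside_def by blast
  then have "min d e > 0" "enlargement B (min d e) \<subseteq> U \<inter> V"
    by (auto simp: enlargement_def subset_iff)
  then show ?thesis
    unfolding uniformly_inside_def by blast
qed

lemma uniformly_inside_INT_atMost:
  fixes n :: nat
  assumes "\<And>i. i \<le> n \<Longrightarrow> uniformly_inside B (U i)"
  shows "uniformly_inside B (\<Inter>i\<le>n. U i)"
  using assms
  by (induction n) (auto simp: atMost_Suc intro!: uniformly_inside_Int)

lemma uniformly_inside_singleton:
  assumes "open U"
  shows "uniformly_inside {x} U \<longleftrightarrow> x \<in> U"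
  using assms uniformly_inside_imp_subset[of "{x}" U]
  by (auto simp: uniformly_inside_def enlargement_def open_contains_ball)

section \<open>Covers without reference to an enumeration\<close>

text \<open>An enumeration with repetitions still loses only finitely many members of the cover before
  the index \<open>n0\<close>; conversely, an enumeration without repetitions meets the finitely many exceptional
  members only at finitely many indices.\<close>

lemma gamma_bs_covers_iff:
  fixes \<BB> :: "'a::metric_space set set"
  shows "\<U> \<in> gamma_bs_covers \<BB> \<longleftrightarrow>
    open_cover \<U> \<and> (\<forall>B\<in>\<BB>. finite {U \<in> \<U>. \<not> uniformly_inside B U})"
proof (intro iffI conjI ballI)
  assume "\<U> \<in> gamma_bs_covers \<BB>"
  then show "open_cover \<U>"
    by (simp add: gamma_bs_covers_def)
next
  fix B assume "\<U> \<in> gamma_bs_covers \<BB>" "B \<in> \<BB>"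
  then obtain U :: "nat \<Rightarrow> 'a set" and n0 \<delta> where U: "\<U> = range U"
    and inside: "\<forall>n\<ge>n0. \<delta> n > 0 \<and> enlargement B (\<delta> n) \<subseteq> U n"
    unfolding gamma_bs_covers_def by blast
  have "uniformly_inside B (U n) \<or> n < n0" for n
    using inside unfolding uniformly_inside_def by (meson not_less)
  then have "{V \<in> \<U>. \<not> uniformly_inside B V} \<subseteq> U ` {..<n0}"
    unfolding U by blast
  then show "finite {V \<in> \<U>. \<not> uniformly_inside B V}"
    by (rule finite_subset) simp
next
  assume \<U>: "open_cover \<U> \<and> (\<forall>B\<in>\<BB>. finite {U \<in> \<U>. \<not> uniformly_inside B U})"
  define U where "U = from_nat_into \<U>"
  have bij: "bij_betw U UNIV \<U>"
    using \<U> unfolding U_def open_cover_def by (intro bij_betw_from_nat_into) auto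
  have "\<exists>n0 \<delta>. \<forall>n\<ge>n0. \<delta> n > 0 \<and> enlargement B (\<delta> n) \<subseteq> U n" if "B \<in> \<BB>" for B
  proof -
    have "finite (U -` {V \<in> \<U>. \<not> uniformly_inside B V})"
      using \<U> that bij by (intro finite_vimageI) (auto simp: bij_betw_def)
    then obtain n0 where "\<forall>n\<in>U -` {V \<in> \<U>. \<not> uniformly_inside B V}. n < n0"
      using finite_nat_set_iff_bounded by blast
    then have "\<forall>n\<ge>n0. uniformly_inside B (U n)"
      using bij by (force simp: bij_betw_def)
    then have "\<forall>n. \<exists>\<delta>. n \<ge> n0 \<longrightarrow> \<delta> > 0 \<and> enlargement B \<delta> \<subseteq> U n"
      unfolding uniformly_inside_def by blast
    then show ?thesis
      by metis
  qed
  then show "\<U> \<in> gamma_bs_covers \<BB>"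
    using \<U> bij unfolding gamma_bs_covers_def bij_betw_def by blast
qed

lemma gamma_covers_eq_gamma_bs_covers:
  "gamma_covers = gamma_bs_covers (range (\<lambda>x::'a::metric_space. {x}))"
proof (rule set_eqI)
  fix \<U> :: "'a set set"
  have "{U \<in> \<U>. \<not> uniformly_inside {x} U} = {U \<in> \<U>. x \<notin> U}" if "open_cover \<U>" for x
    using that by (auto simp: open_cover_def uniformly_inside_singleton)
  then show "\<U> \<in> gamma_covers \<longleftrightarrow> \<U> \<in> gamma_bs_covers (range (\<lambda>x. {x}))"
    by (auto simp: gamma_covers_def gamma_bs_covers_iff)
qed

section \<open>Covers as sequences of proper open subsets\<close>

text \<open>Properness of the sets is what makes the range infinite: with a finite range, some set would
  occur at infinitely many indices, hence contain every point of the space.\<close>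

lemma range_in_gamma_bs_covers:
  fixes U :: "nat \<Rightarrow> 'a::metric_space set"
  assumes cover: "\<Union>\<BB> = UNIV"
    and "\<And>n. open (U n)" and proper: "\<And>n. U n \<noteq> UNIV"
    and inside: "\<And>B. B \<in> \<BB> \<Longrightarrow> \<forall>\<^sub>F n in sequentially. uniformly_inside B (U n)"
  shows "range U \<in> gamma_bs_covers \<BB>"
proof -
  have points: "\<forall>\<^sub>F n in sequentially. x \<in> U n" for x
  proof -
    obtain B where "B \<in> \<BB>" "x \<in> B"
      using cover by (metis UNIV_I UnionE)
    show ?thesis
      using inside[OF \<open>B \<in> \<BB>\<close>]
    proof eventually_elim
      case (elim n)
      then show ?case
        using uniformly_inside_imp_subset \<open>x \<in> B\<close> by blast
    qed
  qed
  have "infinite (range U)"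
  proof
    assume "finite (range U)"
    then obtain m where m: "infinite {n. U n = U m}"
      using pigeonhole_infinite[of UNIV U] by auto
    have "x \<in> U m" for x
    proof -
      obtain N where "\<forall>n\<ge>N. x \<in> U n"
        using points[of x] unfolding eventually_sequentially by blast
      moreover obtain n where "n \<ge> N" "U n = U m"
        using m unfolding infinite_nat_iff_unbounded_le by auto
      ultimately show ?thesis
        by metis
    qed
    then show False
      using proper[of m] by blast
  qed
  moreover have "x \<in> \<Union>(range U)" for x
    using points[of x] unfolding eventually_sequentially by blast
  ultimately have "open_cover (range U)"
    unfolding open_cover_def using assms(2) by auto
  moreover have "finite {V \<in> range U. \<not> uniformly_inside B V}" if "B \<in> \<BB>" for B
  proof -
    have "finite {n. \<not> uniformly_inside B (U n)}"
      using inside[OF that] by (simp add: cofinite_eq_sequentially[symmetric] eventually_cofinite)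
    moreover have "{V \<in> range U. \<not> uniformly_inside B V} = U ` {n. \<not> uniformly_inside B (U n)}"
      by blast
    ultimately show ?thesis
      by simp
  qed
  ultimately show ?thesis
    by (simp add: gamma_bs_covers_iff)
qed

lemma gamma_bs_coversE:
  fixes \<BB> :: "'a::metric_space set set"
  assumes "\<U> \<in> gamma_bs_covers \<BB>"
  obtains U :: "nat \<Rightarrow> 'a set"
  where "\<And>n. U n \<in> \<U>" "\<And>n. open (U n)" "\<And>n. U n \<noteq> UNIV"
    and "\<And>B. B \<in> \<BB> \<Longrightarrow> \<forall>\<^sub>F n in sequentially. uniformly_inside B (U n)"
proof -
  have \<U>: "open_cover \<U>" "\<And>B. B \<in> \<BB> \<Longrightarrow> finite {U \<in> \<U>. \<not> uniformly_inside B U}"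
    using assms by (auto simp: gamma_bs_covers_iff)
  define U where "U = from_nat_into (\<U> - {UNIV})"
  have "bij_betw U UNIV (\<U> - {UNIV})"
    using \<U>(1) unfolding U_def open_cover_def by (intro bij_betw_from_nat_into) auto
  then have U: "inj U" "range U = \<U> - {UNIV}"
    by (auto simp: bij_betw_def)
  have mem: "U n \<in> \<U>" "U n \<noteq> UNIV" for n
    using U(2) by blast+
  have "\<forall>\<^sub>F n in sequentially. uniformly_inside B (U n)" if "B \<in> \<BB>" for B
  proof -
    have "finite (U -` {V \<in> \<U>. \<not> uniformly_inside B V})"
      using \<U>(2)[OF that] U(1) by (rule finite_vimageI)
    then show ?thesis
      using mem by (simp add: cofinite_eq_sequentially[symmetric] eventually_cofinite)
  qed
  then show thesis
    using that[of U] mem \<U>(1) by (auto simp: open_cover_def)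
qed

section \<open>Selecting single members\<close>

text \<open>At most finitely many elements of the union are lost by avoiding the first \<open>n\<close> sets \<open>W k\<close>
  and the first \<open>n\<close> terms of an enumeration of the union. The second restriction is what prevents
  an element from being chosen for infinitely many \<open>n\<close>.\<close>

lemma finite_to_one_selection:
  fixes W :: "nat \<Rightarrow> 'b set"
  assumes fin: "\<And>n. finite (W n)" and inf: "infinite (\<Union>n. W n)"
  obtains k :: "nat \<Rightarrow> nat" and w :: "nat \<Rightarrow> 'b"
  where "\<And>n. n \<le> k n" "\<And>n. w n \<in> W (k n)" "\<And>y. finite {n. w n = y}"
proof -
  have count: "countable (\<Union>n. W n)"
    using fin by (auto intro: countable_finite)
  define e where "e = from_nat_into (\<Union>n. W n)"
  have e: "range e = (\<Union>n. W n)"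
    using inf count unfolding e_def by (intro range_from_nat_into) auto
  have "\<exists>k y. n \<le> k \<and> y \<in> W k \<and> y \<notin> e ` {..<n}" for n
  proof -
    have "finite ((\<Union>k<n. W k) \<union> e ` {..<n})"
      using fin by auto
    then have "\<not> (\<Union>k. W k) \<subseteq> (\<Union>k<n. W k) \<union> e ` {..<n}"
      using inf finite_subset by metis
    then obtain y k where "y \<in> W k" and y: "y \<notin> (\<Union>k<n. W k)" "y \<notin> e ` {..<n}"
      by blast
    moreover from this have "n \<le> k"
      by (auto simp: not_less[symmetric])
    ultimately show ?thesis
      by blast
  qed
  then obtain k w where kw: "\<And>n. n \<le> k n" "\<And>n. w n \<in> W (k n)" "\<And>n. w n \<notin> e ` {..<n}"
    by metis
  have "finite {n. w n = y}" for y
  proof (cases "y \<in> range e")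
    case True
    then obtain j where "y = e j"
      by blast
    then have "{n. w n = y} \<subseteq> {..j}"
      using kw(3) by (force simp: not_le[symmetric])
    then show ?thesis
      by (rule finite_subset) simp
  next
    case False
    then have "{n. w n = y} = {}"
      using kw(2) unfolding e by blast
    then show ?thesis
      by simp
  qed
  then show thesis
    using that kw by blast
qed

lemma S1_imp_Sfin:
  fixes \<A> \<C> :: "'b set set"
  assumes "S1 \<A> \<C>"
  shows "Sfin \<A> \<C>"
  unfolding Sfin_def
proof (intro allI impI)
  fix A :: "nat \<Rightarrow> 'b set"
  assume "\<forall>n. A n \<in> \<A>"
  with assms obtain b where "\<forall>n. b n \<in> A n" "range b \<in> \<C>"
    unfolding S1_def by metis
  then show "\<exists>B. (\<forall>n. finite (B n) \<and> B n \<subseteq> A n) \<and> (\<Union>n. B n) \<in> \<C>"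
    by (intro exI[of _ "\<lambda>n. {b n}"]) (simp add: UNION_singleton_eq_range)
qed

lemma Sfin_imp_S1_gamma_bs_covers:
  fixes \<AA> \<BB> :: "'a::metric_space set set"
  assumes \<AA>: "\<Union>\<AA> = UNIV" and \<BB>: "\<Union>\<BB> = UNIV"
    and Sfin: "Sfin (gamma_bs_covers \<AA>) (gamma_bs_covers \<BB>)"
  shows "S1 (gamma_bs_covers \<AA>) (gamma_bs_covers \<BB>)"
  unfolding S1_def
proof (intro allI impI)
  fix \<U> :: "nat \<Rightarrow> 'a set set"
  assume "\<forall>n. \<U> n \<in> gamma_bs_covers \<AA>"
  then have "\<forall>n. \<exists>U :: nat \<Rightarrow> 'a set. (\<forall>m. U m \<in> \<U> n \<and> open (U m) \<and> U m \<noteq> UNIV) \<and>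
      (\<forall>A\<in>\<AA>. \<forall>\<^sub>F m in sequentially. uniformly_inside A (U m))"
    by (metis gamma_bs_coversE)
  then obtain U :: "nat \<Rightarrow> nat \<Rightarrow> 'a set"
    where U: "\<And>n m. U n m \<in> \<U> n" "\<And>n m. open (U n m)" "\<And>n m. U n m \<noteq> UNIV"
      and U_inside: "\<And>n A. A \<in> \<AA> \<Longrightarrow> \<forall>\<^sub>F m in sequentially. uniformly_inside A (U n m)"
    by metis
  define V where "V n m = (\<Inter>i\<le>n. U i m)" for n m
  have V_subset: "V n m \<subseteq> U i m" if "i \<le> n" for i n m
    using that unfolding V_def by blast
  have "range (V n) \<in> gamma_bs_covers \<AA>" for n
  proof (rule range_in_gamma_bs_covers[OF \<AA>])
    show "open (V n m)" for m
      unfolding V_def using U(2) by auto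
    show "V n m \<noteq> UNIV" for m
      using V_subset[of n n m] U(3)[of n m] by blast
    show "\<forall>\<^sub>F m in sequentially. uniformly_inside A (V n m)" if "A \<in> \<AA>" for A
    proof -
      have "\<forall>\<^sub>F m in sequentially. \<forall>i\<in>{..n}. uniformly_inside A (U i m)"
        using U_inside[OF that] by (intro eventually_ball_finite) auto
      then show ?thesis
        unfolding V_def by eventually_elim (auto intro: uniformly_inside_INT_atMost)
    qed
  qed
  then obtain W :: "nat \<Rightarrow> 'a set set"
    where W: "\<And>n. finite (W n)" "\<And>n. W n \<subseteq> range (V n)" "(\<Union>n. W n) \<in> gamma_bs_covers \<BB>"
    using Sfin unfolding Sfin_def by meson
  have W_inside: "finite {Y \<in> (\<Union>n. W n). \<not> uniformly_inside B Y}" if "B \<in> \<BB>" for B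
    using W(3) that unfolding gamma_bs_covers_iff by blast
  have "infinite (\<Union>n. W n)"
    using W(3) unfolding gamma_bs_covers_iff open_cover_def by blast
  then obtain k w where k: "\<And>n. n \<le> k n" and w: "\<And>n. w n \<in> W (k n)"
    and finite_fibre: "\<And>Y. finite {n. w n = Y}"
    using finite_to_one_selection[of W] W(1) by metis
  have "\<forall>n. \<exists>m. w n = V (k n) m"
    using w W(2) by blast
  then obtain m where m: "\<And>n. w n = V (k n) (m n)"
    by metis
  have "range (\<lambda>n. U n (m n)) \<in> gamma_bs_covers \<BB>"
  proof (rule range_in_gamma_bs_covers[OF \<BB>])
    show "\<forall>\<^sub>F n in sequentially. uniformly_inside B (U n (m n))" if "B \<in> \<BB>" for B
    proof -
      let ?bad = "{Y \<in> (\<Union>n. W n). \<not> uniformly_inside B Y}"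
      have "finite (\<Union>Y\<in>?bad. {n. w n = Y})"
        using W_inside[OF that] finite_fibre by blast
      moreover have "{n. \<not> uniformly_inside B (w n)} \<subseteq> (\<Union>Y\<in>?bad. {n. w n = Y})"
        using w by blast
      ultimately have "finite {n. \<not> uniformly_inside B (w n)}"
        by (rule rev_finite_subset)
      then have "\<forall>\<^sub>F n in sequentially. uniformly_inside B (w n)"
        by (simp add: cofinite_eq_sequentially[symmetric] eventually_cofinite)
      then show ?thesis
      proof eventually_elim
        case (elim n)
        then show ?case
          unfolding m using V_subset[OF k] by (rule uniformly_inside_mono)
      qed
    qed
  qed (use U in auto)
  then show "\<exists>b. (\<forall>n. b n \<in> \<U> n) \<and> range b \<in> gamma_bs_covers \<BB>"
    using U(1) by (intro exI[of _ "\<lambda>n. U n (m n)"]) simp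
qed

lemma S1_iff_Sfin_gamma_bs_covers:
  fixes \<AA> \<BB> :: "'a::metric_space set set"
  assumes "\<Union>\<AA> = UNIV" and "\<Union>\<BB> = UNIV"
  shows "S1 (gamma_bs_covers \<AA>) (gamma_bs_covers \<BB>) \<longleftrightarrow>
    Sfin (gamma_bs_covers \<AA>) (gamma_bs_covers \<BB>)"
  using Sfin_imp_S1_gamma_bs_covers[OF assms] S1_imp_Sfin by blast

theorem theorem3p1:
  fixes \<BB> :: "'a::metric_space set set"
  assumes "infinite (UNIV :: 'a set)"
    and "bornology \<BB>"
    and "has_closed_base \<BB>"
    and "UNIV \<notin> \<BB>"
  shows "(S1 (gamma_bs_covers \<BB>) (gamma_bs_covers \<BB>) \<longleftrightarrow> Sfin (gamma_bs_covers \<BB>) (gamma_bs_covers \<BB>)) \<and>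
         (S1 (gamma_bs_covers \<BB>) gamma_covers \<longleftrightarrow> Sfin (gamma_bs_covers \<BB>) gamma_covers) \<and>
         (S1 gamma_covers (gamma_bs_covers \<BB>) \<longleftrightarrow> Sfin gamma_covers (gamma_bs_covers \<BB>))"
proof -
  have "\<Union>\<BB> = UNIV"
    using assms(2) by (simp add: bornology_def)
  moreover have "\<Union>(range (\<lambda>x::'a. {x})) = UNIV"
    by blast
  ultimately show ?thesis
    unfolding gamma_covers_eq_gamma_bs_covers by (intro conjI S1_iff_Sfin_gamma_bs_covers)
qed

end
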